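(* Let $U$ be a convex open subset of $\mathbb{R}^m$ and let $f:U\to\mathbb{R}^n$ be a locally Lipschitz tame mapping. Suppose that: (1) for every $v\in\mathbb{R}^m$ with $|v|=1$, the set $\Sigma_v(f):=\{A\in M(m,n):Av=0\}\cap\overline{\mathrm{co}}(f)$ is extremal in $\overline{\mathrm{co}}(f)$; (2) $f$ is not constant on any (nondegenerate) segment contained in $U$. Then $f$ is injective.
   Context: $M(m,n)$ is the space of linear maps $\mathbb{R}^m\to\mathbb{R}^n$ (identified with matrices). $B(f)$ is the set of points of $U$ where $f$ is not differentiable, and $\overline{\mathrm{co}}(f)$ is the closed convex hull in $M(m,n)$ of $\mathcal{D}(f)=\{df(x):x\in U\setminus B(f)\}$. A subset $S$ of a set $C$ in a finite-dimensional normed space is extremal in $C$ if for all $x,y\in C$ and $t\in(0,1)$, $tx+(1-t)y\in S$ implies $x,y\in S$ (the empty set is extremal). A continuous map is tame if its graph (a subset of $\mathbb{R}^{m+n}$) is subanalytic or is definable in some o-minimal structure on $(\mathbb{R},+,\cdot,<)$. *)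

theory Defs
  imports "HOL-Analysis.Analysis"
begin

text \<open>
  Linear maps from \<open>real ^ 'm\<close> to \<open>real ^ 'n\<close> are represented by their matrices, of type
  \<open>real ^ 'm ^ 'n\<close>; the differential of \<open>f\<close> at \<open>x\<close> is \<open>jacobian f (at x)\<close>. A map on an open
  set \<open>U\<close> is a total function of which only the values on \<open>U\<close> are used.
\<close>

definition locally_lipschitz_on ::
    "'a::metric_space set \<Rightarrow> ('a \<Rightarrow> 'b::metric_space) \<Rightarrow> bool" where
  "locally_lipschitz_on U f \<longleftrightarrow>
     (\<forall>x\<in>U. \<exists>e>0. \<exists>L. L-lipschitz_on (ball x e \<inter> U) f)"

definition nondiff_set :: "(real ^ 'm) set \<Rightarrow> (real ^ 'm \<Rightarrow> real ^ 'n) \<Rightarrow> (real ^ 'm) set" where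
  "nondiff_set U f = {x \<in> U. \<not> f differentiable (at x)}"

definition differentials ::
    "(real ^ 'm) set \<Rightarrow> (real ^ 'm \<Rightarrow> real ^ 'n) \<Rightarrow> (real ^ 'm ^ 'n) set" where
  "differentials U f = {jacobian f (at x) | x. x \<in> U - nondiff_set U f}"

definition co_bar ::
    "(real ^ 'm) set \<Rightarrow> (real ^ 'm \<Rightarrow> real ^ 'n) \<Rightarrow> (real ^ 'm ^ 'n) set" where
  "co_bar U f = closure (convex hull (differentials U f))"

definition Sigma_dir ::
    "(real ^ 'm) set \<Rightarrow> (real ^ 'm \<Rightarrow> real ^ 'n) \<Rightarrow> real ^ 'm \<Rightarrow> (real ^ 'm ^ 'n) set" where
  "Sigma_dir U f v = {A. A *v v = 0} \<inter> co_bar U f"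

text \<open>Unlike \<open>face_of\<close>, this does not require \<open>S\<close> to be convex.\<close>

definition extremal_in :: "'a::real_vector set \<Rightarrow> 'a set \<Rightarrow> bool" where
  "extremal_in S C \<longleftrightarrow> S \<subseteq> C \<and>
     (\<forall>x\<in>C. \<forall>y\<in>C. \<forall>t. 0 < t \<and> t < 1 \<and> t *\<^sub>R x + (1 - t) *\<^sub>R y \<in> S \<longrightarrow> x \<in> S \<and> y \<in> S)"


text \<open>
  Subanalytic and definable sets involve spaces of varying finite dimension. They are formulated
  in \<open>Euclidean_space n\<close>, whose points are the sequences of reals vanishing from index \<open>n\<close> on.
\<close>

abbreviation Rn :: "nat \<Rightarrow> (nat \<Rightarrow> real) set" where
  "Rn n \<equiv> topspace (Euclidean_space n)"

definition proj :: "nat \<Rightarrow> (nat \<Rightarrow> real) \<Rightarrow> (nat \<Rightarrow> real)" where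
  "proj n x = (\<lambda>i. if i < n then x i else 0)"

text \<open>
  Real analyticity: near every point \<open>a\<close> the function is the sum of a power series in
  \<open>x - a\<close>, indexed by the multi-indices \<open>\<alpha>\<close> (sequences of naturals vanishing from index
  \<open>n\<close> on). For real-valued families, \<open>has_sum\<close> amounts to absolute convergence.
\<close>

definition real_analytic_on :: "nat \<Rightarrow> (nat \<Rightarrow> real) set \<Rightarrow> ((nat \<Rightarrow> real) \<Rightarrow> real) \<Rightarrow> bool" where
  "real_analytic_on n V g \<longleftrightarrow>
     (\<forall>a\<in>V. \<exists>W (c :: (nat \<Rightarrow> nat) \<Rightarrow> real).
        openin (Euclidean_space n) W \<and> a \<in> W \<and> W \<subseteq> V \<and>
        (\<forall>x\<in>W. ((\<lambda>\<alpha>. c \<alpha> * (\<Prod>i<n. (x i - a i) ^ \<alpha> i)) has_sum g x) {\<alpha>. \<forall>i\<ge>n. \<alpha> i = 0}))"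

definition basic_semianalytic :: "nat \<Rightarrow> (nat \<Rightarrow> real) set \<Rightarrow> (nat \<Rightarrow> real) set \<Rightarrow> bool" where
  "basic_semianalytic n V Y \<longleftrightarrow>
     (\<exists>P Q. finite P \<and> finite Q \<and> (\<forall>g \<in> P \<union> Q. real_analytic_on n V g) \<and>
        Y = {x \<in> V. (\<forall>g\<in>P. g x = 0) \<and> (\<forall>g\<in>Q. g x > 0)})"

definition semianalytic :: "nat \<Rightarrow> (nat \<Rightarrow> real) set \<Rightarrow> bool" where
  "semianalytic n X \<longleftrightarrow> X \<subseteq> Rn n \<and>
     (\<forall>a \<in> Rn n. \<exists>V. openin (Euclidean_space n) V \<and> a \<in> V \<and>
        (\<exists>\<Y>. finite \<Y> \<and> (\<forall>Y\<in>\<Y>. basic_semianalytic n V Y) \<and> X \<inter> V = \<Union>\<Y>))"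

text \<open>
  Locally, at every point of the ambient space (not only at points of \<open>X\<close>), a subanalytic set
  \<open>X\<close> is the projection of a relatively compact semianalytic set.
\<close>

definition subanalytic :: "nat \<Rightarrow> (nat \<Rightarrow> real) set \<Rightarrow> bool" where
  "subanalytic n X \<longleftrightarrow> X \<subseteq> Rn n \<and>
     (\<forall>a \<in> Rn n. \<exists>V. openin (Euclidean_space n) V \<and> a \<in> V \<and>
        (\<exists>k A K. semianalytic (n + k) A \<and> compactin (Euclidean_space (n + k)) K \<and> A \<subseteq> K \<and>
           X \<inter> V = proj n ` A))"

text \<open>
  A structure on the real field, given by its sets \<open>S n\<close> of definable subsets of \<open>\<real>\<^sup>n\<close>: Boolean
  algebras, closed under the cylinders \<open>A \<times> \<real>\<close> and \<open>\<real> \<times> A\<close> and under projections, containing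
  the diagonals, the order and the graphs of addition and multiplication. It is o-minimal if
  the definable subsets of the line are exactly the finite unions of intervals (points and
  unbounded intervals included).
\<close>

definition o_minimal_structure :: "(nat \<Rightarrow> (nat \<Rightarrow> real) set set) \<Rightarrow> bool" where
  "o_minimal_structure S \<longleftrightarrow>
     (\<forall>n. algebra (Rn n) (S n)) \<and>
     (\<forall>n. \<forall>A \<in> S n. {x \<in> Rn (Suc n). proj n x \<in> A} \<in> S (Suc n)) \<and>
     (\<forall>n. \<forall>A \<in> S n. {x \<in> Rn (Suc n). (\<lambda>i. x (Suc i)) \<in> A} \<in> S (Suc n)) \<and>
     (\<forall>n. \<forall>A \<in> S (Suc n). proj n ` A \<in> S n) \<and>
     (\<forall>n. \<forall>i<n. \<forall>j<n. {x \<in> Rn n. x i = x j} \<in> S n) \<and>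
     {x \<in> Rn 2. x 0 < x 1} \<in> S 2 \<and>
     {x \<in> Rn 3. x 2 = x 0 + x 1} \<in> S 3 \<and>
     {x \<in> Rn 3. x 2 = x 0 * x 1} \<in> S 3 \<and>
     S 1 = {{x \<in> Rn 1. x 0 \<in> \<Union>\<J>} | \<J>. finite \<J> \<and> (\<forall>J\<in>\<J>. is_interval J)}"

text \<open>
  The graph of \<open>f\<close> as a subset of \<open>\<real>\<^sup>m\<^sup>+\<^sup>n\<close>, with respect to numberings \<open>\<sigma>\<close> and \<open>\<tau>\<close> of the
  coordinates of source and target. Subanalyticity and definability are invariant under
  permutations of the coordinates, so the choice of numberings in \<open>tame_on\<close> is immaterial.
\<close>

definition graph_on ::
    "(nat \<Rightarrow> 'm) \<Rightarrow> (nat \<Rightarrow> 'n) \<Rightarrow> (real ^ 'm) set \<Rightarrow> (real ^ 'm \<Rightarrow> real ^ 'n) \<Rightarrow> (nat \<Rightarrow> real) set" where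
  "graph_on \<sigma> \<tau> U f =
     (\<lambda>x i. if i < CARD('m) then x $ \<sigma> i
            else if i < CARD('m) + CARD('n) then f x $ \<tau> (i - CARD('m)) else 0) ` U"

definition tame_on :: "(real ^ 'm) set \<Rightarrow> (real ^ 'm \<Rightarrow> real ^ 'n) \<Rightarrow> bool" where
  "tame_on U f \<longleftrightarrow> continuous_on U f \<and>
     (\<exists>\<sigma> \<tau>. bij_betw \<sigma> {..<CARD('m)} UNIV \<and> bij_betw \<tau> {..<CARD('n)} UNIV \<and>
        (subanalytic (CARD('m) + CARD('n)) (graph_on \<sigma> \<tau> U f) \<or>
         (\<exists>S. o_minimal_structure S \<and> graph_on \<sigma> \<tau> U f \<in> S (CARD('m) + CARD('n)))))"

end

theory Submission
  imports Defs
begin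

text \<open>
  If \<open>f a = f b\<close> and \<open>c\<close> lies between \<open>a\<close> and \<open>b\<close>, the mean value theorem for locally Lipschitz maps
  gives \<open>A, B\<close> in \<open>co_bar U f\<close> with \<open>A (c - a) = f c - f a\<close> and \<open>B (b - c) = f b - f c\<close>. A convex
  combination of \<open>A\<close> and \<open>B\<close> kills the direction \<open>b - a\<close>, so by extremality \<open>A\<close> does too, whence
  \<open>f c = f a\<close>; thus \<open>f\<close> is constant on the segment.

  The mean value theorem follows from Rademacher's theorem: if \<open>f b - f a\<close> were separated from the
  vectors \<open>A (b - a)\<close> by a hyperplane, integrating along a generic segment parallel and close to
  \<open>[a, b]\<close>, almost all of whose points are points of differentiability, gives a contradiction.

  For Rademacher's theorem, one-dimensional Lipschitz functions are indefinite integrals, hence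
  directional derivatives exist almost everywhere. They are additive in the direction almost
  everywhere because the integrals over boxes of the defect of additivity vanish, by translation
  invariance. The Lipschitz condition then upgrades this to differentiability.
\<close>

section \<open>Null sets and parallel lines\<close>


lemma AE_lborel_translate:
  fixes c :: "'a::euclidean_space"
  assumes "AE x in lborel. P x"
  shows "AE x in lborel. P (c + x)"
proof (rule AE_distrD[of "(+) c" lborel borel P])
  show "(+) c \<in> lborel \<rightarrow>\<^sub>M borel"
    by simp
  show "AE x in distr lborel borel ((+) c). P x"
    unfolding lborel_distr_plus by (rule assms)
qed

text \<open>By Fubini, for almost every \<open>s\<close>, hence for at least one, the exceptional
  set shifted by \<open>s *\<^sub>R v\<close> is null; translation invariance undoes the shift.
  Measurability of \<open>P\<close> is what allows the exchange of quantifiers.\<close>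

lemma AE_lborel_of_lines:
  fixes v :: "'a::euclidean_space"
  assumes P [measurable]: "Measurable.pred borel P"
    and lines: "\<And>x. AE s in lborel. P (x + s *\<^sub>R v)"
  shows "AE x in lborel. P x"
proof -
  have "AE s in lborel. AE x in lborel. P (x + s *\<^sub>R v)"
  proof (subst lborel_pair.AE_commute)
    have "Measurable.pred (lborel \<Otimes>\<^sub>M lborel) (\<lambda>p :: real \<times> 'a. P (snd p + fst p *\<^sub>R v))"
      by measurable
    then show "{p \<in> space (lborel \<Otimes>\<^sub>M lborel). P (snd p + fst p *\<^sub>R v)} \<in> sets (lborel \<Otimes>\<^sub>M lborel)"
      by (simp only: pred_def)
  qed (use lines in simp)
  then have "\<exists>s. AE x in lborel. P (x + s *\<^sub>R v)"
    by (rule eventually_happens'[rotated]) (simp add: ae_filter_eq_bot_iff)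
  then obtain s where "AE x in lborel. P (x + s *\<^sub>R v)" ..
  from AE_lborel_translate[OF this, of "- (s *\<^sub>R v)"] show ?thesis
    by simp
qed

text \<open>Fubini in the opposite direction. Here \<open>P\<close> may be non-measurable, since the
  exceptional set is first enlarged to a Borel null set \<open>N\<close>; this suits
  differentiability.\<close>

lemma AE_lborel_lines:
  fixes v :: "'a::euclidean_space"
  assumes "AE x in lborel. P x"
  shows "AE x in lborel. AE s in (lborel :: real measure). P (x + s *\<^sub>R v)"
proof -
  obtain N where N: "{x. \<not> P x} \<subseteq> N" and [measurable]: "N \<in> sets borel" and "emeasure lborel N = 0"
    using AE_E[OF assms] by auto
  then have "AE x in lborel. x \<notin> N"
    by (auto simp: null_sets_def intro!: AE_not_in)
  then have "AE s in (lborel :: real measure). AE x in lborel. x + s *\<^sub>R v \<notin> N"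
    using AE_lborel_translate[of "\<lambda>x. x \<notin> N" "s *\<^sub>R v" for s] by (simp add: add.commute)
  then have "AE x in lborel. AE s in (lborel :: real measure). x + s *\<^sub>R v \<notin> N"
  proof (subst lborel_pair.AE_commute)
    have "Measurable.pred (lborel \<Otimes>\<^sub>M lborel) (\<lambda>p :: 'a \<times> real. fst p + snd p *\<^sub>R v \<notin> N)"
      by measurable
    then show "{p \<in> space (lborel \<Otimes>\<^sub>M lborel). fst p + snd p *\<^sub>R v \<notin> N} \<in> sets (lborel \<Otimes>\<^sub>M lborel)"
      by (simp only: pred_def)
  qed simp
  then show ?thesis
    using N by (auto elim!: eventually_mono)
qed

lemma AE_lborel_if_negligible:
  assumes "negligible N" and "\<And>x. x \<notin> N \<Longrightarrow> P x"
  shows "AE x in lborel. P x"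
proof -
  have "AE x in lebesgue. x \<notin> N"
    using assms(1) by (simp add: negligible_iff_null_sets AE_not_in)
  then show ?thesis
    using assms(2) by (auto simp: AE_completion_iff elim!: eventually_mono)
qed

section \<open>Lipschitz functions of one variable\<close>

text \<open>Lebesgue's differentiation theorem on the intervals \<open>{x..x + t}\<close>, sampled
  at \<open>t = 1 / Suc n\<close>.\<close>

lemma integral_difference_quotients_tendsto_AE:
  fixes h :: "real \<Rightarrow> real"
  assumes "\<And>a b. a \<le> b \<Longrightarrow> (h has_integral g b - g a) {a..b}"
  shows "AE x in lborel. (\<lambda>n. real (Suc n) * (g (x + 1 / Suc n) - g x)) \<longlonglongrightarrow> h x"
proof -
  have "h integrable_on cbox a b" for a b
    by (cases "a \<le> b") (use assms in auto)
  then obtain N where "negligible N" and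
    N: "\<And>x e. \<lbrakk>x \<notin> N; 0 < e\<rbrakk> \<Longrightarrow> \<exists>d>0. \<forall>t. 0 < t \<and> t < d \<longrightarrow>
           norm (integral (cbox x (x + t *\<^sub>R One)) h /\<^sub>R t ^ DIM(real) - h x) < e"
    using integrable_ccontinuous_explicit[of h] by blast
  show ?thesis
  proof (rule AE_lborel_if_negligible[OF \<open>negligible N\<close>])
    fix x assume "x \<notin> N"
    show "(\<lambda>n. real (Suc n) * (g (x + 1 / Suc n) - g x)) \<longlonglongrightarrow> h x"
    proof (rule metric_LIMSEQ_I)
      fix e :: real assume "0 < e"
      then obtain d where "d > 0" and
        d: "\<And>t. 0 < t \<Longrightarrow> t < d \<Longrightarrow> norm (integral {x..x + t} h / t - h x) < e"
        using N[OF \<open>x \<notin> N\<close> \<open>0 < e\<close>] by (auto simp: divide_inverse_commute)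
      obtain n0 where n0: "1 / Suc n0 < d"
        using \<open>d > 0\<close> nat_approx_posE by blast
      have "dist (real (Suc n) * (g (x + 1 / Suc n) - g x)) (h x) < e" if "n \<ge> n0" for n
      proof -
        have "1 / Suc n < d"
          using n0 that by (smt (verit) frac_le of_nat_0_less_iff zero_less_Suc of_nat_mono Suc_le_mono)
        then show ?thesis
          using d[of "1 / Suc n"] integral_unique[OF assms, of x "x + 1 / Suc n"]
          by (simp add: dist_norm mult.commute)
      qed
      then show "\<exists>n0. \<forall>n\<ge>n0. dist (real (Suc n) * (g (x + 1 / Suc n) - g x)) (h x) < e"
        by blast
    qed
  qed
qed

text \<open>
  The density is the Radon-Nikodym derivative of the image of Lebesgue measure under the inverse
  of \<open>F\<close>, which assigns measure \<open>F b - F a\<close> to \<open>{a..b}\<close>; the Lipschitz condition makes it absolutely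
  continuous.
\<close>

lemma lipschitz_expanding_density:
  fixes F :: "real \<Rightarrow> real"
  assumes lip: "K-lipschitz_on UNIV F" and expand: "\<And>x y. x \<le> y \<Longrightarrow> y - x \<le> F y - F x"
  shows "\<exists>k. \<forall>a b. a \<le> b \<longrightarrow> (k has_integral F b - F a) {a..b}"
proof -
  have mono: "F x < F y \<longleftrightarrow> x < y" for x y
    using expand[of x y] expand[of y x] by linarith
  have contF: "continuous_on UNIV F"
    using lip by (rule lipschitz_on_continuous_on)
  have "\<exists>x. F x = y" for y
  proof -
    \<comment> \<open>Expansion gives \<open>F c \<ge> F 0 + c \<ge> y\<close> and
      \<open>F (- c) \<le> F 0 - c \<le> y\<close>, so \<open>y\<close> is an intermediate
      value.\<close>
    define c where "c = \<bar>y - F 0\<bar>"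
    have "F (- c) \<le> y" "y \<le> F c"
      using expand[of "-c" 0] expand[of 0 c] by (auto simp: c_def)
    moreover have "continuous_on {-c..c} F"
      using contF continuous_on_subset by blast
    ultimately show ?thesis
      using IVT'[of F "-c" y c] by (auto simp: c_def)
  qed
  then have "surj F" by (metis surjI)
  have "inj F" using mono by (metis injI linorder_neqE less_irrefl)
  define H where "H = inv F"
  have HF [simp]: "H (F x) = x" and FH [simp]: "F (H y) = y" for x y
    using \<open>surj F\<close> \<open>inj F\<close> by (auto simp: H_def surj_f_inv_f)
  have "1-lipschitz_on UNIV H"
  proof (rule lipschitz_onI)
    show "dist (H x) (H y) \<le> 1 * dist x y" for x y
      using expand[of "H x" "H y"] expand[of "H y" "H x"] by (simp add: dist_real_def) linarith
  qed auto
  then have "continuous_on UNIV H"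
    by (rule lipschitz_on_continuous_on)
  then have [measurable]: "H \<in> borel_measurable borel"
    by (rule borel_measurable_continuous_onI)
  define \<mu> where "\<mu> = distr lborel borel H"
  have vimage: "H -` A = F ` A" for A
    by (auto simp: image_iff) (metis FH)
  have emeasure_\<mu>: "emeasure \<mu> A = emeasure lborel (F ` A)" if "A \<in> sets borel" for A
    using that by (simp add: \<mu>_def emeasure_distr vimage)
  have "absolutely_continuous lborel \<mu>"
    unfolding absolutely_continuous_def
  proof
    fix A :: "real set" assume A: "A \<in> null_sets lborel"
    then have "negligible A"
      by (simp add: negligible_iff_null_sets null_sets_completionI)
    \<comment> \<open>Lipschitz maps of the line send null sets to null sets.\<close>
    then have "negligible (F ` A)"
    proof (rule negligible_locally_Lipschitz_image[OF order_refl])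
      fix x assume "x \<in> A"
      have "norm (F y - F x) \<le> K * norm (y - x)" for y
        using lipschitz_on_normD[OF lip] by blast
      then show "\<exists>T B. open T \<and> x \<in> T \<and> (\<forall>y\<in>A \<inter> T. norm (F y - F x) \<le> B * norm (y - x))"
        by blast
    qed
    moreover have "F ` A \<in> sets borel"
      using A measurable_sets_borel[OF \<open>H \<in> borel_measurable borel\<close>, of A]
      by (simp add: vimage[symmetric] null_sets_def)
    ultimately show "A \<in> null_sets \<mu>"
      using A by (auto simp: null_sets_def emeasure_\<mu> \<mu>_def[THEN arg_cong[where f=sets]]
           negligible_iff_null_sets)
  qed
  then obtain k where [measurable]: "k \<in> borel_measurable borel" and k: "density lborel k = \<mu>"
    using sigma_finite_measure.Radon_Nikodym[OF sigma_finite_lborel, of \<mu>] by (auto simp: \<mu>_def)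
  have nn: "(\<integral>\<^sup>+x. k x * indicator {a..b} x \<partial>lborel) = ennreal (F b - F a)" if "a \<le> b" for a b
  proof -
    have "F ` {a..b} = {F a..F b}"
    proof -
      have "F a \<le> y \<Longrightarrow> y \<le> F b \<Longrightarrow> y \<in> F ` {a..b}" for y
        using mono[of b "H y"] mono[of "H y" a] by (intro image_eqI[of _ _ "H y"]) auto
      then show ?thesis
        using mono by (auto simp: not_less[symmetric])
    qed
    then have "emeasure \<mu> {a..b} = ennreal (F b - F a)"
      using expand[OF that] that by (simp add: emeasure_\<mu>)
    then show ?thesis
      by (simp add: k[symmetric] emeasure_density)
  qed
  have "((\<lambda>x. enn2real (k x)) has_integral F b - F a) {a..b}" if "a \<le> b" for a b
  proof -
    \<comment> \<open>The density is extended-valued. Its integral over \<open>{a..b}\<close> is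
      finite, so \<open>enn2real\<close> alters it there only on a null set.\<close>
    have "AE x in lborel. k x * indicator {a..b} x \<noteq> \<infinity>"
      by (rule nn_integral_PInf_AE) (auto simp: nn[OF that])
    then have "(\<integral>\<^sup>+x. ennreal (enn2real (k x) * indicator {a..b} x) \<partial>lborel) =
        (\<integral>\<^sup>+x. k x * indicator {a..b} x \<partial>lborel)"
      by (intro nn_integral_cong_AE) (auto simp: indicator_def less_top elim!: eventually_mono)
    then have "((\<lambda>x. enn2real (k x) * indicator {a..b} x) has_integral F b - F a) UNIV"
      using nn[OF that] expand[OF that] that by (intro nn_integral_has_integral) auto
    moreover have "(\<lambda>x. enn2real (k x) * indicator {a..b} x) = (\<lambda>x. if x \<in> {a..b} then enn2real (k x) else 0)"
      by (auto simp: indicator_def)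
    ultimately show ?thesis
      using has_integral_restrict_UNIV[of "{a..b}" "\<lambda>x. enn2real (k x)"] by simp
  qed
  then show ?thesis by blast
qed

lemma lipschitz_indefinite_integral:
  fixes g :: "real \<Rightarrow> real"
  assumes "L-lipschitz_on UNIV g"
  obtains h where "\<And>a b. a \<le> b \<Longrightarrow> (h has_integral g b - g a) {a..b}"
proof -
  have g: "\<bar>g x - g y\<bar> \<le> L * \<bar>x - y\<bar>" for x y
    using lipschitz_onD[OF assms] by (simp add: dist_real_def)
  \<comment> \<open>The slopes of \<open>g\<close> are at least \<open>- L\<close>, so adding slope
    \<open>L + 1\<close> makes all slopes at least 1; the constant is subtracted from the density at
    the end.\<close>
  define F where "F = (\<lambda>x. g x + (L + 1) * x)"
  have "(L + \<bar>L + 1\<bar> * 1)-lipschitz_on UNIV F"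
    unfolding F_def by (intro lipschitz_on_add assms lipschitz_on_cmult_real lipschitz_on_id)
  moreover have "y - x \<le> F y - F x" if "x \<le> y" for x y
    using g[of y x] that by (simp add: F_def algebra_simps)
  ultimately obtain k where k: "\<And>a b. a \<le> b \<Longrightarrow> (k has_integral F b - F a) {a..b}"
    using lipschitz_expanding_density by blast
  show thesis
  proof
    fix a b :: real assume "a \<le> b"
    from has_integral_diff[OF k[OF this] has_integral_const_real[of "L + 1" a b]] \<open>a \<le> b\<close>
    show "((\<lambda>x. k x - (L + 1)) has_integral g b - g a) {a..b}"
      by (simp add: F_def algebra_simps)
  qed
qed

section \<open>Directional difference quotients\<close>


text \<open>
  The increments are only \<open>1 / Suc n\<close>, so measurability is immediate; for Lipschitz functions this
  sequence determines differentiability.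
\<close>

definition dquot :: "('a::real_vector \<Rightarrow> real) \<Rightarrow> 'a \<Rightarrow> nat \<Rightarrow> 'a \<Rightarrow> real" where
  "dquot f v n x = real (Suc n) * (f (x + (1 / real (Suc n)) *\<^sub>R v) - f x)"

text \<open>Where the quotients diverge, \<open>lim\<close> is an unspecified value; values are
  evaluated only where convergence is known, which is almost everywhere.\<close>

definition dirderiv :: "('a::real_vector \<Rightarrow> real) \<Rightarrow> 'a \<Rightarrow> 'a \<Rightarrow> real" where
  "dirderiv f v x = lim (\<lambda>n. dquot f v n x)"

section \<open>Translated integrals and vanishing integrals over boxes\<close>

lemma lborel_integral_translate:
  fixes g :: "'a::euclidean_space \<Rightarrow> real"
  assumes "g \<in> borel_measurable borel"
  shows "(\<integral>x. g (c + x) \<partial>lborel) = (\<integral>x. g x \<partial>lborel)"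
  using integral_distr[of "(+) c" lborel borel g] assms by (simp add: lborel_distr_plus)

text \<open>By Lebesgue differentiation, almost every value of \<open>h\<close> is the limit of its
  averages over small cubes with corner \<open>x\<close>, and these averages are all 0.\<close>

lemma AE_eq_0_if_cbox_integrals_eq_0:
  fixes h :: "'a::euclidean_space \<Rightarrow> real"
  assumes "\<And>a b. (h has_integral 0) (cbox a b)"
  shows "AE x in lborel. h x = 0"
proof -
  have "h integrable_on cbox a b" for a b
    using assms by blast
  then obtain N where "negligible N" and
    N: "\<And>x e. \<lbrakk>x \<notin> N; 0 < e\<rbrakk> \<Longrightarrow> \<exists>d>0. \<forall>t. 0 < t \<and> t < d \<longrightarrow>
           norm (integral (cbox x (x + t *\<^sub>R One)) h /\<^sub>R t ^ DIM('a) - h x) < e"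
    using integrable_ccontinuous_explicit[of h] by blast
  show ?thesis
  proof (rule AE_lborel_if_negligible[OF \<open>negligible N\<close>])
    fix x assume "x \<notin> N"
    show "h x = 0"
    proof (rule ccontr)
      assume "h x \<noteq> 0"
      then obtain d where "d > 0" and
        d: "\<And>t. 0 < t \<Longrightarrow> t < d \<Longrightarrow> norm (integral (cbox x (x + t *\<^sub>R One)) h /\<^sub>R t ^ DIM('a) - h x) < \<bar>h x\<bar>"
        using N[OF \<open>x \<notin> N\<close>, of "\<bar>h x\<bar>"] by auto
      then show False
        using d[of "d / 2"] integral_unique[OF assms] by simp
    qed
  qed
qed

section \<open>Directional derivatives of a Lipschitz function: existence and additivity almost
  everywhere\<close>

context
  fixes f :: "'a::euclidean_space \<Rightarrow> real" and L :: real
  assumes lip: "L-lipschitz_on UNIV f"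
begin

lemma lipschitz_borel_measurable [measurable]: "f \<in> borel_measurable borel"
  using lip by (intro borel_measurable_continuous_onI lipschitz_on_continuous_on)

lemma dquot_measurable [measurable]: "dquot f v n \<in> borel_measurable borel"
  unfolding dquot_def[abs_def] by measurable

lemma dirderiv_measurable [measurable]: "dirderiv f v \<in> borel_measurable borel"
  unfolding dirderiv_def[abs_def] by measurable

text \<open>The bound is uniform in \<open>n\<close> and \<open>x\<close>. It later carries
  convergence and additivity from a dense set of directions to all directions.\<close>

lemma dquot_lipschitz: "\<bar>dquot f v n x - dquot f w n x\<bar> \<le> L * norm (v - w)"
proof -
  have "\<bar>dquot f v n x - dquot f w n x\<bar> = real (Suc n) *
      \<bar>f (x + (1 / real (Suc n)) *\<^sub>R v) - f (x + (1 / real (Suc n)) *\<^sub>R w)\<bar>"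
    by (simp add: dquot_def abs_mult flip: right_diff_distrib)
  also have "\<dots> \<le> real (Suc n) * (L * norm ((1 / real (Suc n)) *\<^sub>R v - (1 / real (Suc n)) *\<^sub>R w))"
    using lipschitz_on_normD[OF lip, of "x + (1 / real (Suc n)) *\<^sub>R v" "x + (1 / real (Suc n)) *\<^sub>R w"]
    by (intro mult_left_mono) auto
  also have "\<dots> = L * norm (v - w)"
    by (simp flip: scaleR_right_diff_distrib del: of_nat_Suc)
  finally show ?thesis .
qed

lemma dquot_bound: "\<bar>dquot f v n x\<bar> \<le> L * norm v"
  using dquot_lipschitz[of v n x 0] by (simp add: dquot_def)

text \<open>On each line parallel to \<open>v\<close>, the restriction of \<open>f\<close> is a
  Lipschitz function of one variable, whose quotients converge almost everywhere; Fubini assembles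
  the lines.\<close>

lemma convergent_dquot_AE: "AE x in lborel. convergent (\<lambda>n. dquot f v n x)"
proof (rule AE_lborel_of_lines[where v = v])
  \<comment> \<open>Convergence is replaced by the Cauchy condition, which involves only countably
    many measurable conditions.\<close>
  show "Measurable.pred borel (\<lambda>x. convergent (\<lambda>n. dquot f v n x))"
    using sets_Collect_Cauchy[of "dquot f v" borel] by (simp add: pred_def Cauchy_convergent_iff)
  fix x
  define g where "g = (\<lambda>s. f (x + s *\<^sub>R v))"
  have "(L * norm v)-lipschitz_on UNIV g"
  proof (rule lipschitz_onI)
    show "dist (g s) (g t) \<le> L * norm v * dist s t" for s t
      using lipschitz_onD[OF lip, of "x + s *\<^sub>R v" "x + t *\<^sub>R v"]
      by (simp add: g_def dist_norm mult_ac flip: scaleR_left_diff_distrib)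
  qed (use lipschitz_on_nonneg[OF lip] in simp)
  then obtain h where "\<And>a b. a \<le> b \<Longrightarrow> (h has_integral g b - g a) {a..b}"
    using lipschitz_indefinite_integral by blast
  then have "AE s in lborel. (\<lambda>n. real (Suc n) * (g (s + 1 / Suc n) - g s)) \<longlonglongrightarrow> h s"
    by (rule integral_difference_quotients_tendsto_AE)
  then show "AE s in lborel. convergent (\<lambda>n. dquot f v n (x + s *\<^sub>R v))"
    by (rule eventually_mono) (auto simp: convergent_def dquot_def g_def algebra_simps)
qed

lemma dquot_tendsto_dirderiv_AE: "AE x in lborel. (\<lambda>n. dquot f v n x) \<longlonglongrightarrow> dirderiv f v x"
  using convergent_dquot_AE by (rule eventually_mono) (simp add: dirderiv_def convergent_LIMSEQ_iff)

text \<open>This turns the defect of additivity into the difference between a quotient at a shifted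
  point and at the point itself, with the shift tending to 0.\<close>

lemma dquot_add:
  "dquot f (u + v) n x - dquot f u n x = dquot f v n ((1 / real (Suc n)) *\<^sub>R u + x)"
  by (simp add: dquot_def algebra_simps)

text \<open>A change of variables moves the shift from the quotient, of whose dependence on
  \<open>n\<close> nothing is known beyond a bound, to the indicator of the box. The shifted
  indicators converge off the null frontier, and dominated convergence applies.\<close>

lemma dquot_box_translate_tendsto_0:
  "(\<lambda>n. \<integral>x. indicator (cbox a b) x *
      (dquot f v n ((1 / real (Suc n)) *\<^sub>R u + x) - dquot f v n x) \<partial>lborel) \<longlonglongrightarrow> 0"
proof -
  define E where "E = cbox a b"
  define u' where "u' = (\<lambda>n. (1 / real (Suc n)) *\<^sub>R u)"
  define C where "C = L * norm v"
  have u'0: "u' \<longlonglongrightarrow> 0"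
    unfolding u'_def using tendsto_scaleR[OF LIMSEQ_Suc[OF lim_1_over_n] tendsto_const] by fastforce
  have norm_u': "norm (u' n) \<le> norm u" for n
    by (simp add: u'_def field_simps)
  have [measurable]: "E \<in> sets borel" by (simp add: E_def)
  obtain R where R: "\<And>x. x \<in> E \<Longrightarrow> norm x \<le> R"
    using bounded_cbox unfolding E_def bounded_iff by blast
  \<comment> \<open>One ball containing the box and all its translates by \<open>u' n\<close>, so
    that \<open>C * indicator B\<close> dominates every integrand.\<close>
  define B where "B = cball (0::'a) (R + norm u)"
  have [measurable]: "B \<in> sets borel" by (simp add: B_def)
  have B: "x \<in> B" if "x \<in> E \<or> - u' n + x \<in> E" for x n
    using that R[of x] R[of "- u' n + x"] norm_u'[of n] norm_triangle_sub[of x "u' n"]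
    by (auto simp: B_def intro: add_increasing2)
  have "emeasure lborel B < \<infinity>"
    unfolding B_def by (rule emeasure_lborel_cball_finite)
  then have intB: "integrable lborel (\<lambda>x. C * indicator B x)"
    by simp
  have bound: "norm (s * dquot f v n y) \<le> C * indicator B x"
    if "\<bar>s\<bar> \<le> 1" "s \<noteq> 0 \<Longrightarrow> x \<in> B" for s x y n
  proof (cases "s = 0")
    case False
    then show ?thesis
      using that mult_mono[OF that(1) dquot_bound[of v n y]] by (simp add: C_def abs_mult)
  qed (use lipschitz_on_nonneg[OF lip] in \<open>auto simp: C_def indicator_def\<close>)
  have integ: "integrable lborel (\<lambda>x. s x * dquot f v n (c + x))"
    if "s \<in> borel_measurable borel" "\<And>x. \<bar>s x\<bar> \<le> 1" "\<And>x. s x \<noteq> 0 \<Longrightarrow> x \<in> B" for s c n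
  proof (rule Bochner_Integration.integrable_bound[OF intB])
    show "AE x in lborel. norm (s x * dquot f v n (c + x)) \<le> norm (C * indicator B x)"
      using that(2,3) by (intro AE_I2 order_trans[OF bound]) auto
  qed (use that(1) in measurable)
  have eq: "(\<integral>x. indicator E x * (dquot f v n (u' n + x) - dquot f v n x) \<partial>lborel) =
      (\<integral>x. (indicator E (- u' n + x) - indicator E x) * dquot f v n x \<partial>lborel)" for n
  proof -
    have int1: "integrable lborel (\<lambda>x. indicator E x * dquot f v n (u' n + x))"
      by (rule integ) (auto simp: indicator_def intro: B split: if_splits)
    have int2: "integrable lborel (\<lambda>x. indicator E x * dquot f v n x)"
      by (rule integ[where c = 0, simplified]) (auto simp: indicator_def intro: B split: if_splits)
    have int3: "integrable lborel (\<lambda>x. indicator E (- u' n + x) * dquot f v n x)"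
      by (rule integ[where c = 0, simplified]) (auto simp: indicator_def intro: B split: if_splits)
    have "(\<integral>x. indicator E x * (dquot f v n (u' n + x) - dquot f v n x) \<partial>lborel) =
        (\<integral>x. indicator E x * dquot f v n (u' n + x) \<partial>lborel) - (\<integral>x. indicator E x * dquot f v n x \<partial>lborel)"
      using int1 int2 by (simp add: right_diff_distrib)
    also have "(\<integral>x. indicator E x * dquot f v n (u' n + x) \<partial>lborel) =
        (\<integral>x. indicator E (- u' n + x) * dquot f v n x \<partial>lborel)"
      using lborel_integral_translate[of "\<lambda>x. indicator E x * dquot f v n (u' n + x)" "- u' n"]
      by simp
    finally show ?thesis
      using int2 int3 by (simp add: left_diff_distrib)
  qed
  have "(\<lambda>n. \<integral>x. (indicator E (- u' n + x) - indicator E x) * dquot f v n x \<partial>lborel) \<longlonglongrightarrow>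
      (\<integral>x. (0::real) \<partial>(lborel :: 'a measure))"
  proof (rule integral_dominated_convergence[OF _ _ intB])
    have "AE x in lborel. x \<notin> frontier E"
      by (rule AE_lborel_if_negligible[OF negligible_convex_frontier]) (auto simp: E_def)
    then show "AE x in lborel. (\<lambda>n. (indicator E (- u' n + x) - indicator E x) * dquot f v n x) \<longlonglongrightarrow> 0"
    proof (rule eventually_mono)
      fix x assume x: "x \<notin> frontier E"
      have lim: "(\<lambda>n. - u' n + x) \<longlonglongrightarrow> x"
        using tendsto_add[OF tendsto_minus[OF u'0] tendsto_const[of x]] by simp
      \<comment> \<open>Off the frontier, \<open>x\<close> lies in the interior or in the open
        complement of \<open>E\<close>, so small shifts do not change membership.\<close>
      have "\<forall>\<^sub>F n in sequentially. (- u' n + x \<in> E) = (x \<in> E)"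
      proof (cases "x \<in> E")
        case True
        then have "x \<in> interior E"
          using x closure_subset by (auto simp: frontier_def)
        then have "\<forall>\<^sub>F n in sequentially. - u' n + x \<in> interior E"
          using lim topological_tendstoD by blast
        then show ?thesis
          using True interior_subset by (auto elim!: eventually_mono)
      next
        case False
        then have "x \<in> - E" by simp
        moreover have "open (- E)" by (simp add: E_def open_Compl closed_cbox)
        ultimately have "\<forall>\<^sub>F n in sequentially. - u' n + x \<in> - E"
          using lim topological_tendstoD by blast
        then show ?thesis
          using False by (auto elim!: eventually_mono)
      qed
      then show "(\<lambda>n. (indicator E (- u' n + x) - indicator E x) * dquot f v n x) \<longlonglongrightarrow> 0"
        by (intro tendsto_eventually) (auto elim!: eventually_mono simp: indicator_def)
    qed
    show "AE x in lborel. norm ((indicator E (- u' n + x) - indicator E x) * dquot f v n x) \<le> C * indicator B x" for n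
      by (intro AE_I2 bound) (auto simp: indicator_def intro: B[of _ n] split: split_of_bool_asm if_splits)
  qed auto
  then have "(\<lambda>n. \<integral>x. indicator E x * (dquot f v n (u' n + x) - dquot f v n x) \<partial>lborel) \<longlonglongrightarrow> 0"
    unfolding eq by simp
  then show ?thesis
    unfolding E_def u'_def .
qed

text \<open>The defect \<open>r\<close> is the almost everywhere limit of the uniformly bounded
  \<open>s n\<close>, whose integrals over any box tend to 0. So \<open>r\<close> has zero integral
  over every box and vanishes almost everywhere.\<close>

lemma dirderiv_add_AE: "AE x in lborel. dirderiv f (u + v) x = dirderiv f u x + dirderiv f v x"
proof -
  define r where "r = (\<lambda>x. dirderiv f (u + v) x - dirderiv f u x - dirderiv f v x)"
  define s where "s = (\<lambda>n x. dquot f (u + v) n x - dquot f u n x - dquot f v n x)"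
  define C where "C = L * norm v + L * norm v"
  have s_eq: "s n x = dquot f v n ((1 / real (Suc n)) *\<^sub>R u + x) - dquot f v n x" for n x
    by (simp add: s_def dquot_add)
  have bound: "norm (s n x) \<le> C" for n x
    unfolding s_eq C_def real_norm_def
    by (intro order_trans[OF abs_triangle_ineq4] add_mono dquot_bound)
  have [measurable]: "r \<in> borel_measurable borel" "s n \<in> borel_measurable borel" for n
    by (auto simp: r_def s_def)
  have lim: "AE x in lborel. (\<lambda>n. s n x) \<longlonglongrightarrow> r x"
    using dquot_tendsto_dirderiv_AE[of "u + v"] dquot_tendsto_dirderiv_AE[of u] dquot_tendsto_dirderiv_AE[of v]
    by eventually_elim (auto simp: s_def r_def intro!: tendsto_diff)
  have "(r has_integral 0) (cbox a b)" for a b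
  proof -
    have w: "integrable lborel (\<lambda>x. C * indicator (cbox a b) x)"
      by (simp add: emeasure_lborel_cbox_eq)
    have lim': "AE x in lborel. (\<lambda>n. indicator (cbox a b) x * s n x) \<longlonglongrightarrow> indicator (cbox a b) x * r x"
      using lim by eventually_elim (auto intro!: tendsto_mult)
    have dom: "AE x in lborel. norm (indicator (cbox a b) x * s n x) \<le> C * indicator (cbox a b) x" for n
      using bound by (intro AE_I2) (auto simp: indicator_def)
    have "(\<lambda>n. \<integral>x. indicator (cbox a b) x * s n x \<partial>lborel) \<longlonglongrightarrow> (\<integral>x. indicator (cbox a b) x * r x \<partial>lborel)"
      by (rule integral_dominated_convergence[OF _ _ w lim' dom]) auto
    moreover have "(\<lambda>n. \<integral>x. indicator (cbox a b) x * s n x \<partial>lborel) \<longlonglongrightarrow> 0"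
      unfolding s_eq by (rule dquot_box_translate_tendsto_0)
    ultimately have 0: "(\<integral>x. indicator (cbox a b) x * r x \<partial>lborel) = 0"
      using LIMSEQ_unique by blast
    have "integrable lborel (\<lambda>x. indicator (cbox a b) x * r x)"
      by (rule integrable_dominated_convergence[OF _ _ w lim' dom]) auto
    moreover have "(\<lambda>x. indicator (cbox a b) x * r x) = (\<lambda>x. if x \<in> cbox a b then r x else 0)"
      by (auto simp: indicator_def)
    ultimately have "((\<lambda>x. if x \<in> cbox a b then r x else 0) has_integral 0) UNIV"
      using has_integral_integral_lborel 0 by metis
    then show ?thesis
      by (simp add: has_integral_restrict_UNIV)
  qed
  then have "AE x in lborel. r x = 0"
    by (rule AE_eq_0_if_cbox_integrals_eq_0)
  then show ?thesis
    by (rule eventually_mono) (simp add: r_def)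
qed

end

section \<open>Rademacher's theorem\<close>


text \<open>Additivity gives homogeneity for integers. For real \<open>c\<close>, the error of
  homogeneity multiplied by \<open>n\<close> equals the error for the fractional part of
  \<open>n * c\<close>, which is bounded independently of \<open>n\<close>; hence it is 0.\<close>

lemma additive_lipschitz_imp_linear:
  fixes p :: "'a::real_normed_vector \<Rightarrow> real"
  assumes add: "\<And>u v. p (u + v) = p u + p v"
    and lip: "\<And>u v. \<bar>p u - p v\<bar> \<le> L * norm (u - v)"
  shows "linear p"
proof (rule linearI)
  fix c :: real and v :: 'a
  have p0: "p 0 = 0"
    using add[of 0 0] by simp
  have minus: "p (- w) = - p w" for w
    using add[of w "- w"] p0 by simp
  have nat: "p (real n *\<^sub>R w) = real n * p w" for n w
    by (induction n) (simp_all add: p0 add algebra_simps)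
  have int: "p (of_int m *\<^sub>R w) = of_int m * p w" for m w
    using nat[of "nat \<bar>m\<bar>" w] minus[of "real (nat \<bar>m\<bar>) *\<^sub>R w"] by (cases "m \<ge> 0") (auto simp: minus)
  have le: "\<bar>p w\<bar> \<le> L * norm w" for w
    using lip[of w 0] by (simp add: p0)
  have "real n * \<bar>p (c *\<^sub>R v) - c * p v\<bar> \<le> 2 * (L * norm v)" for n
  proof -
    define r where "r = frac (real n * c)"
    have r: "0 \<le> r" "r < 1" and split: "real n * c = r + of_int \<lfloor>real n * c\<rfloor>"
      unfolding r_def frac_ge_0 by (simp_all add: frac_lt_1) (simp add: frac_def)
    have "real n * p (c *\<^sub>R v) = p ((real n * c) *\<^sub>R v)"
      by (simp flip: nat)
    also have "\<dots> = p (r *\<^sub>R v) + of_int \<lfloor>real n * c\<rfloor> * p v"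
      by (subst split) (simp only: scaleR_left_distrib add int)
    finally have "real n * (p (c *\<^sub>R v) - c * p v) = p (r *\<^sub>R v) - r * p v"
      using arg_cong[OF split, of "\<lambda>t. t * p v"] by (simp add: right_diff_distrib distrib_right mult.assoc)
    then have "real n * \<bar>p (c *\<^sub>R v) - c * p v\<bar> = \<bar>p (r *\<^sub>R v) - r * p v\<bar>"
      by (metis abs_mult abs_of_nat)
    also have "\<dots> \<le> L * norm (r *\<^sub>R v) + r * (L * norm v)"
      using le[of "r *\<^sub>R v"] mult_left_mono[OF le[of v] r(1)] r(1)
        abs_triangle_ineq4[of "p (r *\<^sub>R v)" "r * p v"]
      by (simp add: abs_mult algebra_simps)
    also have "\<dots> = r * (2 * (L * norm v))"
      using r(1) by simp
    also have "\<dots> \<le> 1 * (2 * (L * norm v))"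
      using r le[of v] by (intro mult_right_mono) auto
    finally show ?thesis by simp
  qed
  then have "\<bar>p (c *\<^sub>R v) - c * p v\<bar> \<le> 0"
    using reals_Archimedean3[of "\<bar>p (c *\<^sub>R v) - c * p v\<bar>"] by (meson not_le)
  then show "p (c *\<^sub>R v) = c *\<^sub>R p v" by simp
qed (rule add)

context
  fixes f :: "'a::euclidean_space \<Rightarrow> real" and L :: real
  assumes lip: "L-lipschitz_on UNIV f"
begin

text \<open>Compactness of the unit ball and the uniform Lipschitz bound make the convergence of the
  quotients uniform in the direction. An arbitrary small increment is written as
  \<open>1 / Suc n\<close> times a vector of the unit ball.\<close>

lemma has_derivative_dirderiv:
  assumes conv: "\<And>v. (\<lambda>n. dquot f v n x) \<longlonglongrightarrow> p v" and "linear p"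
  shows "(f has_derivative p) (at x)"
  unfolding has_derivative_at_alt
proof (intro conjI allI impI)
  show "bounded_linear p"
    using \<open>linear p\<close> linear_conv_bounded_linear by blast
  have L: "0 \<le> L" using lip lipschitz_on_nonneg by blast
  have p_lip: "\<bar>p u - p v\<bar> \<le> L * norm (u - v)" for u v
    by (rule LIMSEQ_le_const2[OF tendsto_rabs[OF tendsto_diff[OF conv conv]]])
      (use dquot_lipschitz[OF lip] in blast)
  fix e :: real assume "0 < e"
  \<comment> \<open>Replacing a direction by a net point costs at most \<open>e / 8\<close> in the
    quotient and \<open>e / 8\<close> in \<open>p\<close>; with \<open>e / 4\<close> at the net
    point this makes \<open>e / 2\<close>, and the factor 2 from
    \<open>1 / Suc n \<le> 2 * norm h\<close> uses up the rest.\<close>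
  define d where "d = e / (8 * (L + 1))"
  have "d > 0" and "L * d \<le> e / 8"
    using \<open>0 < e\<close> L by (simp_all add: d_def field_simps)
  obtain K where "finite K" and K: "cball (0::'a) 1 \<subseteq> (\<Union>k\<in>K. ball k d)"
    using seq_compact_imp_totally_bounded[OF compact_imp_seq_compact[OF compact_cball[of "0::'a" 1]]]
      \<open>d > 0\<close> by blast
  have "\<forall>\<^sub>F n in sequentially. \<forall>k\<in>K. dist (dquot f k n x) (p k) < e / 4"
    using \<open>finite K\<close> \<open>0 < e\<close> by (intro eventually_ball_finite ballI tendstoD[OF conv]) auto
  then obtain N where N: "\<And>n k. n \<ge> N \<Longrightarrow> k \<in> K \<Longrightarrow> \<bar>dquot f k n x - p k\<bar> < e / 4"
    unfolding eventually_sequentially dist_real_def by blast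
  show "\<exists>r>0. \<forall>y. norm (y - x) < r \<longrightarrow> norm (f y - f x - p (y - x)) \<le> e * norm (y - x)"
  proof (intro exI conjI allI impI)
    show "0 < 1 / real (Suc N)" by simp
    fix y assume small: "norm (y - x) < 1 / real (Suc N)"
    define h where "h = y - x"
    show "norm (f y - f x - p (y - x)) \<le> e * norm (y - x)"
    proof (cases "h = 0")
      case True
      then show ?thesis
        using linear_0[OF \<open>linear p\<close>] by (simp add: h_def)
    next
      case False
      \<comment> \<open>Chosen so that \<open>Suc n\<close> is the integer part of
        \<open>1 / norm h\<close>: then \<open>Suc n *\<^sub>R h\<close> stays in the unit ball and
        \<open>1 / Suc n\<close> is comparable to \<open>norm h\<close>.\<close>
      define n where "n = nat \<lfloor>1 / norm h\<rfloor> - 1"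
      have "real (Suc N) < 1 / norm h"
        using small False by (simp add: h_def field_simps)
      then have "\<lfloor>1 / norm h\<rfloor> \<ge> int (Suc N)"
        by (simp add: le_floor_iff)
      then have n: "n \<ge> N" "int (Suc n) = \<lfloor>1 / norm h\<rfloor>"
        by (auto simp: n_def)
      then have *: "real (Suc n) \<le> 1 / norm h" "1 / norm h < real (Suc n) + 1"
        using of_int_floor_le[of "1 / norm h"] real_of_int_floor_add_one_gt[of "1 / norm h"]
        by (simp_all flip: n(2))
      have s: "1 / real (Suc n) \<le> 2 * norm h"
      proof -
        have "1 < (real (Suc n) + 1) * norm h"
          using *(2) False by (simp add: pos_divide_less_eq del: of_nat_Suc)
        also have "\<dots> \<le> (2 * real (Suc n)) * norm h"
          by (intro mult_right_mono) auto
        finally show ?thesis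
          by (simp add: divide_le_eq mult_ac del: of_nat_Suc)
      qed
      define z where "z = real (Suc n) *\<^sub>R h"
      have h_eq: "h = (1 / real (Suc n)) *\<^sub>R z"
        by (simp add: z_def del: of_nat_Suc)
      have "norm z \<le> 1"
        using *(1) False by (simp add: z_def pos_le_divide_eq del: of_nat_Suc)
      then obtain k where k: "k \<in> K" "norm (z - k) < d"
        using K by (force simp: dist_norm norm_minus_commute)
      have "L * norm (z - k) \<le> e / 8"
        using k(2) L \<open>L * d \<le> e / 8\<close> by (meson less_imp_le mult_left_mono order_trans)
      then have "\<bar>dquot f z n x - p z\<bar> \<le> e / 2"
        using dquot_lipschitz[OF lip, of z n x k] N[OF n(1) k(1)] p_lip[of z k] by linarith
      have "f y - f x - p (y - x) = (1 / real (Suc n)) * (dquot f z n x - p z)"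
        using linear_scale[OF \<open>linear p\<close>, of "1 / real (Suc n)" z]
        by (simp add: dquot_def right_diff_distrib del: of_nat_Suc flip: h_eq) (simp add: h_def)
      then have "norm (f y - f x - p (y - x)) = (1 / real (Suc n)) * \<bar>dquot f z n x - p z\<bar>"
        by (simp add: abs_mult del: of_nat_Suc)
      also have "\<dots> \<le> 2 * norm h * (e / 2)"
        using s \<open>\<bar>dquot f z n x - p z\<bar> \<le> e / 2\<close> by (intro mult_mono) auto
      finally show ?thesis
        by (simp add: h_def mult.commute)
    qed
  qed
qed

text \<open>The quotients are Lipschitz in the direction, uniformly in \<open>n\<close>, so
  convergence and then additivity extend from \<open>D\<close> to all directions. The limit is thus
  additive and Lipschitz, hence linear.\<close>

lemma differentiable_if_dirderiv_additive_on_dense: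
  assumes dense: "\<And>X. open X \<Longrightarrow> X \<noteq> {} \<Longrightarrow> \<exists>d\<in>D. d \<in> X"
    and conv: "\<And>v. v \<in> D \<Longrightarrow> convergent (\<lambda>n. dquot f v n x)"
    and add: "\<And>u v. u \<in> D \<Longrightarrow> v \<in> D \<Longrightarrow> dirderiv f (u + v) x = dirderiv f u x + dirderiv f v x"
  shows "f differentiable (at x)"
proof -
  have L: "0 \<le> L" using lip lipschitz_on_nonneg by blast
  have approx: "\<exists>w\<in>D. L * norm (v - w) < e" if "e > 0" for v e
  proof -
    have "0 < e / (L + 1)"
      using \<open>e > 0\<close> L by simp
    then obtain w where "w \<in> D" "w \<in> ball v (e / (L + 1))"
      using dense[of "ball v (e / (L + 1))"] by auto
    then have "(L + 1) * norm (v - w) < e"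
      using L by (simp add: dist_norm field_simps)
    moreover have "L * norm (v - w) \<le> (L + 1) * norm (v - w)"
      by (intro mult_right_mono) auto
    ultimately show ?thesis
      using \<open>w \<in> D\<close> by (intro bexI[of _ w]) auto
  qed
  have conv': "(\<lambda>n. dquot f v n x) \<longlonglongrightarrow> dirderiv f v x" for v
  proof -
    have "Cauchy (\<lambda>n. dquot f v n x)"
    proof (rule metric_CauchyI)
      fix e :: real assume "0 < e"
      then obtain w where "w \<in> D" and w: "L * norm (v - w) < e / 3"
        using approx[of "e / 3"] by auto
      then have "Cauchy (\<lambda>n. dquot f w n x)"
        using conv convergent_Cauchy by blast
      then obtain M where M: "\<And>m n. m \<ge> M \<Longrightarrow> n \<ge> M \<Longrightarrow> dist (dquot f w m x) (dquot f w n x) < e / 3"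
        using metric_CauchyD[of "\<lambda>n. dquot f w n x" "e / 3"] \<open>0 < e\<close> by auto
      have "dist (dquot f v m x) (dquot f v n x) < e" if "m \<ge> M" "n \<ge> M" for m n
        using w dquot_lipschitz[OF lip, of v m x w] dquot_lipschitz[OF lip, of v n x w] M[OF that]
        unfolding dist_real_def by linarith
      then show "\<exists>M. \<forall>m\<ge>M. \<forall>n\<ge>M. dist (dquot f v m x) (dquot f v n x) < e" by blast
    qed
    then show ?thesis
      unfolding dirderiv_def by (intro convergent_LIMSEQ_iff[THEN iffD1] real_Cauchy_convergent)
  qed
  have p_lip: "\<bar>dirderiv f u x - dirderiv f v x\<bar> \<le> L * norm (u - v)" for u v
    by (rule LIMSEQ_le_const2[OF tendsto_rabs[OF tendsto_diff[OF conv' conv']]])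
      (use dquot_lipschitz[OF lip] in blast)
  have "dirderiv f (u + v) x = dirderiv f u x + dirderiv f v x" for u v
  proof -
    \<comment> \<open>Each of the two approximation errors, below \<open>e / 4\<close>, enters
      twice: once for its own direction and once for the sum.\<close>
    have "\<bar>dirderiv f (u + v) x - (dirderiv f u x + dirderiv f v x)\<bar> \<le> 0 + e" if "e > 0" for e
    proof -
      obtain u' v' where D: "u' \<in> D" "v' \<in> D" and
        small: "L * norm (u - u') < e / 4" "L * norm (v - v') < e / 4"
        using approx[of "e / 4"] \<open>e > 0\<close> by (meson divide_pos_pos zero_less_numeral)
      have "L * norm ((u + v) - (u' + v')) \<le> L * (norm (u - u') + norm (v - v'))"
        using L by (intro mult_left_mono norm_diff_triangle_ineq)
      then show ?thesis
        using add[OF D] small p_lip[of u u'] p_lip[of v v'] p_lip[of "u + v" "u' + v'"]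
        by (simp add: distrib_left)
    qed
    then show ?thesis
      using field_le_epsilon[of "\<bar>dirderiv f (u + v) x - (dirderiv f u x + dirderiv f v x)\<bar>" 0] by simp
  qed
  from additive_lipschitz_imp_linear[OF this p_lip]
  have "(f has_derivative (\<lambda>v. dirderiv f v x)) (at x)"
    by (rule has_derivative_dirderiv[OF conv'])
  then show ?thesis
    using differentiable_def by blast
qed

text \<open>A countable dense set of directions leaves only countably many null sets to
  discard.\<close>

lemma lipschitz_differentiable_AE_real: "AE x in lborel. f differentiable (at x)"
proof -
  obtain D :: "'a set" where "countable D" and dense: "\<And>X. open X \<Longrightarrow> X \<noteq> {} \<Longrightarrow> \<exists>d\<in>D. d \<in> X"
    by (erule countable_dense_setE)
  have "AE x in lborel. \<forall>v\<in>D. convergent (\<lambda>n. dquot f v n x)"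
    using convergent_dquot_AE[OF lip] by (simp add: AE_ball_countable[OF \<open>countable D\<close>])
  moreover have "AE x in lborel. \<forall>u\<in>D. \<forall>v\<in>D. dirderiv f (u + v) x = dirderiv f u x + dirderiv f v x"
    using dirderiv_add_AE[OF lip] by (simp add: AE_ball_countable[OF \<open>countable D\<close>])
  ultimately show ?thesis
    by eventually_elim (rule differentiable_if_dirderiv_additive_on_dense[OF dense], auto)
qed

end

theorem rademacher:
  fixes f :: "'a::euclidean_space \<Rightarrow> 'b::euclidean_space"
  assumes "L-lipschitz_on UNIV f"
  shows "AE x in lborel. f differentiable (at x)"
proof -
  have "L-lipschitz_on UNIV (\<lambda>x. f x \<bullet> i)" if "i \<in> Basis" for i
  proof (rule lipschitz_onI)
    show "dist (f x \<bullet> i) (f y \<bullet> i) \<le> L * dist x y" for x y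
      using Basis_le_norm[OF that, of "f x - f y"] lipschitz_onD[OF assms, of x y]
      by (simp add: dist_norm inner_diff_left)
  qed (use lipschitz_on_nonneg[OF assms] in simp)
  then have "AE x in lborel. \<forall>i\<in>Basis. (\<lambda>x. f x \<bullet> i) differentiable (at x)"
    by (intro AE_finite_allI lipschitz_differentiable_AE_real) auto
  then show ?thesis
    unfolding differentiable_componentwise_within[of f] .
qed

section \<open>The mean value theorem and injectivity\<close>


text \<open>\<open>g\<close> is the integral of a density \<open>h\<close> that agrees almost
  everywhere in the interval with the derivative, so \<open>h\<close> is at most
  \<open>\<beta>\<close> there almost everywhere; this bound is integrated.\<close>

lemma lipschitz_increment_le:
  fixes g :: "real \<Rightarrow> real"
  assumes lip: "L-lipschitz_on UNIV g" and "a \<le> b"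
    and le: "AE s in lborel. s \<in> {a<..<b} \<longrightarrow> (\<exists>d\<le>\<beta>. (g has_real_derivative d) (at s))"
  shows "g b - g a \<le> \<beta> * (b - a)"
proof -
  obtain h where h: "\<And>a b. a \<le> b \<Longrightarrow> (h has_integral g b - g a) {a..b}"
    using lipschitz_indefinite_integral[OF lip] by blast
  have "AE s in lborel. (\<lambda>n. real (Suc n) * (g (s + 1 / Suc n) - g s)) \<longlonglongrightarrow> h s"
    using h by (rule integral_difference_quotients_tendsto_AE)
  then have "AE s in lborel. s \<in> {a<..<b} \<longrightarrow> h s \<le> \<beta>"
    using le
  proof eventually_elim
    case (elim s)
    show ?case
    proof
      assume "s \<in> {a<..<b}"
      then obtain d where "d \<le> \<beta>" and d: "(g has_real_derivative d) (at s)"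
        using elim(2) by blast
      have "filterlim (\<lambda>n. 1 / real (Suc n)) (at 0) sequentially"
        unfolding filterlim_at using LIMSEQ_Suc[OF lim_1_over_n] by auto
      from filterlim_compose[OF d[unfolded DERIV_def] this]
      have "(\<lambda>n. real (Suc n) * (g (s + 1 / Suc n) - g s)) \<longlonglongrightarrow> d"
        by (simp add: mult.commute)
      with elim(1) have "h s = d"
        by (rule LIMSEQ_unique)
      then show "h s \<le> \<beta>" using \<open>d \<le> \<beta>\<close> by simp
    qed
  qed
  then obtain N where N: "{s. \<not> (s \<in> {a<..<b} \<longrightarrow> h s \<le> \<beta>)} \<subseteq> N" "N \<in> null_sets lborel"
    by (auto elim!: AE_E simp: null_sets_def)
  then have "negligible N"
    by (simp add: negligible_iff_null_sets null_sets_completionI)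
  then have negl: "negligible (N \<union> {a, b})"
    by (simp add: negligible_Un)
  \<comment> \<open>Overwriting \<open>h\<close> by \<open>\<beta>\<close> on a null set makes the
    bound hold everywhere without changing the integral.\<close>
  have "((\<lambda>s. if s \<in> N \<union> {a, b} then \<beta> else h s) has_integral g b - g a) {a..b}"
    by (rule has_integral_spike[OF negl _ h[OF \<open>a \<le> b\<close>]]) auto
  moreover have "((\<lambda>s. \<beta>) has_integral \<beta> * (b - a)) {a..b}"
    using has_integral_const_real[of \<beta> a b] \<open>a \<le> b\<close> by (simp add: mult.commute)
  ultimately show ?thesis
    by (rule has_integral_le) (use N(1) in \<open>auto simp: less_le\<close>)
qed

section \<open>Bounds on the Jacobian matrices of a Lipschitz map\<close>

lemma norm_jacobian_mult_le:
  fixes f :: "real ^ 'm \<Rightarrow> real ^ 'n"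
  assumes "L-lipschitz_on UNIV f" and "f differentiable (at x)"
  shows "norm (jacobian f (at x) *v v) \<le> L * norm v"
proof -
  have "0 \<le> L" using assms(1) lipschitz_on_nonneg by blast
  have "(f has_derivative (*v) (jacobian f (at x))) (at x)"
    using assms(2) jacobian_works by blast
  then have approx: "\<And>e. 0 < e \<Longrightarrow> \<exists>d>0. \<forall>y. norm (y - x) < d \<longrightarrow>
      norm (f y - f x - jacobian f (at x) *v (y - x)) \<le> e * norm (y - x)"
    unfolding has_derivative_at_alt by blast
  show ?thesis
  proof (rule field_le_epsilon)
    fix e :: real assume "0 < e"
    then obtain d where "d > 0" and d: "\<And>y. norm (y - x) < d \<Longrightarrow>
        norm (f y - f x - jacobian f (at x) *v (y - x)) \<le> e / (norm v + 1) * norm (y - x)"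
      using approx[of "e / (norm v + 1)"] by (auto simp: add_nonneg_pos)
    define c where "c = norm v + 1"
    define t where "t = d / (2 * c)"
    have "norm v \<ge> 0" by simp
    then have "c > 0" "norm v < 2 * c"
      unfolding c_def by argo+
    then have "t > 0"
      using \<open>d > 0\<close> by (simp add: t_def)
    then have "t * norm v < t * (2 * c)"
      using \<open>norm v < 2 * c\<close> by simp
    also have "\<dots> = d"
      using \<open>c > 0\<close> by (simp add: t_def)
    finally have "norm ((x + t *\<^sub>R v) - x) < d"
      using \<open>t > 0\<close> by simp
    from d[OF this] have "norm (f (x + t *\<^sub>R v) - f x - t *\<^sub>R (jacobian f (at x) *v v)) \<le> e / (norm v + 1) * (t * norm v)"
      using \<open>t > 0\<close> by (simp add: matrix_vector_mult_scaleR)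
    moreover have "norm (f (x + t *\<^sub>R v) - f x) \<le> L * (t * norm v)"
      using lipschitz_on_normD[OF assms(1), of "x + t *\<^sub>R v" x] \<open>t > 0\<close> by simp
    ultimately have "norm (t *\<^sub>R (jacobian f (at x) *v v)) \<le> L * (t * norm v) + e / (norm v + 1) * (t * norm v)"
      using norm_triangle_sub[of "t *\<^sub>R (jacobian f (at x) *v v)" "f (x + t *\<^sub>R v) - f x"]
      by (simp add: norm_minus_commute)
    then have "t * norm (jacobian f (at x) *v v) \<le> t * (L * norm v + e * (norm v / (norm v + 1)))"
      using \<open>t > 0\<close> by (simp add: algebra_simps)
    then have "norm (jacobian f (at x) *v v) \<le> L * norm v + e * (norm v / (norm v + 1))"
      using \<open>t > 0\<close> by simp
    also have "e * (norm v / (norm v + 1)) \<le> e * 1"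
      using \<open>0 < e\<close> by (intro mult_left_mono) (auto simp: divide_le_eq add_nonneg_pos)
    finally show "norm (jacobian f (at x) *v v) \<le> L * norm v + e" by simp
  qed
qed

text \<open>Makes the closed convex hull of Jacobian matrices compact. Applying a matrix to the
  coordinate vectors bounds its entries by \<open>L\<close>.\<close>

lemma bounded_jacobians:
  fixes f :: "real ^ 'm \<Rightarrow> real ^ 'n"
  assumes "L-lipschitz_on UNIV f"
  shows "bounded {jacobian f (at x) | x. f differentiable (at x)}"
proof (rule boundedI)
  fix A assume "A \<in> {jacobian f (at x) | x. f differentiable (at x)}"
  then have A: "norm (A *v v) \<le> L * norm v" for v
    using norm_jacobian_mult_le[OF assms] by auto
  have "\<bar>A $ i $ j\<bar> \<le> L" for i j
    using A[of "axis j 1"] component_le_norm_cart[of "A *v axis j 1" i]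
    by (simp add: matrix_vector_mul_component inner_axis norm_axis_1)
  then have "norm (A $ i) \<le> (\<Sum>j\<in>(UNIV::'m set). L)" for i
    by (intro order_trans[OF norm_le_l1_cart] sum_mono) auto
  then have "(\<Sum>i\<in>(UNIV::'n set). norm (A $ i)) \<le> (\<Sum>i\<in>(UNIV::'n set). \<Sum>j\<in>(UNIV::'m set). L)"
    by (intro sum_mono)
  then show "norm A \<le> (\<Sum>i\<in>(UNIV::'n set). \<Sum>j\<in>(UNIV::'m set). L)"
    unfolding norm_vec_def by (intro order_trans[OF L2_set_le_sum]) auto
qed

text \<open>The candidate values \<open>A *v (b - a)\<close> form a compact convex set, so a missing
  value \<open>f b - f a\<close> is strictly separated from it. The separation survives small
  parallel displacements of the segment, and almost all of these satisfy the opposite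
  inequality.\<close>

lemma lipschitz_mean_value:
  fixes f :: "real ^ 'm \<Rightarrow> real ^ 'n"
  assumes lip: "L-lipschitz_on UNIV f" and "open W" and seg: "closed_segment a b \<subseteq> W"
  shows "\<exists>A \<in> closure (convex hull {jacobian f (at x) | x. x \<in> W \<and> f differentiable (at x)}).
           A *v (b - a) = f b - f a"
proof -
  define D where "D = {jacobian f (at x) | x. x \<in> W \<and> f differentiable (at x)}"
  define T where "T = (\<lambda>A :: real ^ 'm ^ 'n. A *v (b - a))"
  have "linear T"
    unfolding T_def by (rule linearI) (simp_all add: matrix_vector_mult_add_rdistrib scaleR_matrix_vector_assoc)
  have "bounded D"
    by (rule bounded_subset[OF bounded_jacobians[OF lip]]) (auto simp: D_def)
  then have "compact (closure (convex hull D))"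
    by (simp add: bounded_convex_hull)
  then have "closed (T ` closure (convex hull D))"
    using \<open>linear T\<close> by (intro compact_imp_closed compact_continuous_image linear_continuous_on)
      (auto simp: linear_conv_bounded_linear)
  moreover have "convex (T ` closure (convex hull D))"
    by (intro convex_linear_image \<open>linear T\<close> convex_closure convex_convex_hull)
  moreover have "f b - f a \<in> T ` closure (convex hull D)"
    if cl: "closed (T ` closure (convex hull D))" and cv: "convex (T ` closure (convex hull D))"
  proof (rule ccontr)
    assume "f b - f a \<notin> T ` closure (convex hull D)"
    then obtain w \<beta> where w: "w \<bullet> (f b - f a) < \<beta>" "\<And>A. A \<in> closure (convex hull D) \<Longrightarrow> \<beta> < w \<bullet> T A"
      using separating_hyperplane_closed_point[OF cv cl] by blast
    have D: "\<beta> < w \<bullet> (jacobian f (at x) *v (b - a))" if "x \<in> W" "f differentiable (at x)" for x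
      using w(2)[of "jacobian f (at x)"] that closure_subset hull_subset[of D convex]
      unfolding T_def D_def by blast
    \<comment> \<open>The compact segment has a positive distance to the complement of
      \<open>W\<close>, so displacements shorter than \<open>e\<close> keep it inside
      \<open>W\<close>.\<close>
    obtain e where "e > 0" and e: "\<And>x y. x \<in> closed_segment a b \<Longrightarrow> dist x y < e \<Longrightarrow> y \<in> W"
    proof -
      have "closed (- W)" "closed_segment a b \<inter> - W = {}"
        using \<open>open W\<close> seg by auto
      then obtain e where "e > 0" "\<forall>x\<in>closed_segment a b. \<forall>y\<in>- W. e \<le> dist x y"
        using separate_compact_closed[OF compact_segment, of "- W" a b] by blast
      then show thesis
        by (intro that[of e]) force+
    qed
    \<comment> \<open>The sign turns the lower bound \<open>\<beta>\<close> for derivatives into the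
      upper bound \<open>- \<beta>\<close> required by
      \<open>lipschitz_increment_le\<close>.\<close>
    have lipg: "(norm w * L * norm (b - a))-lipschitz_on UNIV (\<lambda>s. - (w \<bullet> f (y + s *\<^sub>R (b - a))))" for y
    proof (rule lipschitz_onI)
      fix s t :: real
      have "\<bar>w \<bullet> (f (y + s *\<^sub>R (b - a)) - f (y + t *\<^sub>R (b - a)))\<bar>
          \<le> norm w * (L * norm ((y + s *\<^sub>R (b - a)) - (y + t *\<^sub>R (b - a))))"
        by (intro order_trans[OF Cauchy_Schwarz_ineq2] mult_left_mono lipschitz_on_normD[OF lip]) auto
      also have "(y + s *\<^sub>R (b - a)) - (y + t *\<^sub>R (b - a)) = (s - t) *\<^sub>R (b - a)"
        by (simp add: algebra_simps)
      finally show "dist (- (w \<bullet> f (y + s *\<^sub>R (b - a)))) (- (w \<bullet> f (y + t *\<^sub>R (b - a))))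
          \<le> norm w * L * norm (b - a) * dist s t"
        by (simp add: dist_real_def inner_diff_right mult_ac)
    qed (use lipschitz_on_nonneg[OF lip] in auto)
    have "AE y in lborel. AE s in lborel. f differentiable (at (y + s *\<^sub>R (b - a)))"
      by (rule AE_lborel_lines[OF rademacher[OF lip]])
    then have good: "AE y in lborel. dist a y < e \<longrightarrow> \<beta> \<le> w \<bullet> (f (y + (b - a)) - f y)"
    proof eventually_elim
      case (elim y)
      show ?case
      proof
        assume "dist a y < e"
        define g where "g = (\<lambda>s. - (w \<bullet> f (y + s *\<^sub>R (b - a))))"
        have "AE s in lborel. s \<in> {0<..<1} \<longrightarrow> (\<exists>d\<le>-\<beta>. (g has_real_derivative d) (at s))"
          using elim
        proof eventually_elim
          case (elim s)
          define x where "x = y + s *\<^sub>R (b - a)"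
          show ?case
          proof
            assume "s \<in> {0<..<1}"
            then have "a + s *\<^sub>R (b - a) \<in> closed_segment a b"
              by (auto simp: in_segment algebra_simps intro!: exI[of _ s])
            then have "x \<in> W"
              using e[of "a + s *\<^sub>R (b - a)" x] \<open>dist a y < e\<close> by (simp add: x_def dist_norm)
            have f': "(f has_derivative (*v) (jacobian f (at x))) (at (y + s *\<^sub>R (b - a)))"
              using elim jacobian_works x_def by blast
            have "((\<lambda>s. y + s *\<^sub>R (b - a)) has_derivative (\<lambda>t. t *\<^sub>R (b - a))) (at s)"
              by (auto intro!: derivative_eq_intros)
            from has_derivative_compose[OF this f'] have "(g has_derivative (\<lambda>t. - (w \<bullet> (jacobian f (at x) *v (t *\<^sub>R (b - a)))))) (at s)"
              unfolding g_def by (intro has_derivative_minus has_derivative_inner_right)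
            then have "(g has_real_derivative - (w \<bullet> (jacobian f (at x) *v (b - a)))) (at s)"
              unfolding has_field_derivative_def
              by (rule has_derivative_eq_rhs) (simp add: fun_eq_iff matrix_vector_mult_scaleR)
            moreover have "\<beta> < w \<bullet> (jacobian f (at x) *v (b - a))"
              using D[OF \<open>x \<in> W\<close>] elim by (simp add: x_def)
            ultimately show "\<exists>d\<le>-\<beta>. (g has_real_derivative d) (at s)"
              by (intro exI[of _ "- (w \<bullet> (jacobian f (at x) *v (b - a)))"]) simp
          qed
        qed
        from lipschitz_increment_le[OF lipg[of y, folded g_def] zero_le_one this]
        have "g 1 - g 0 \<le> - \<beta>"
          by simp
        then show "\<beta> \<le> w \<bullet> (f (y + (b - a)) - f y)"
          by (simp add: g_def inner_diff_right)
      qed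
    qed
    \<comment> \<open>The starting points near \<open>a\<close> that violate \<open>good\<close>.
      They form a null set which is open by continuity, hence empty, although it contains
      \<open>a\<close>.\<close>
    define G where "G = {y. w \<bullet> (f (y + (b - a)) - f y) < \<beta>} \<inter> ball a e"
    have contf: "continuous_on UNIV f"
      using lip by (rule lipschitz_on_continuous_on)
    have "continuous_on UNIV (\<lambda>y. f (y + (b - a)))"
      by (rule continuous_on_compose2[OF contf]) (auto intro: continuous_intros)
    with contf have "continuous_on UNIV (\<lambda>y. w \<bullet> (f (y + (b - a)) - f y))"
      by (intro continuous_on_inner continuous_on_diff continuous_on_const)
    then have "open G"
      unfolding G_def by (intro open_Int open_Collect_less) auto
    have "a \<in> G"
      using w(1) \<open>e > 0\<close> by (simp add: G_def)
    have "AE y in lborel. y \<notin> G"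
      using good by eventually_elim (auto simp: G_def dist_norm norm_minus_commute)
    then have "G \<in> null_sets lborel"
      using AE_iff_measurable[of G lborel "\<lambda>y. y \<notin> G"] \<open>open G\<close> by (simp add: null_sets_def)
    then have "G = {}"
      using open_not_negligible[OF \<open>open G\<close>] by (auto simp: negligible_iff_null_sets null_sets_completionI)
    with \<open>a \<in> G\<close> show False by blast
  qed
  ultimately have "f b - f a \<in> T ` closure (convex hull D)"
    by blast
  then obtain A where "A \<in> closure (convex hull D)" "T A = f b - f a"
    by (metis imageE)
  then show ?thesis
    unfolding T_def D_def by blast
qed

section \<open>From Lipschitz maps on the whole space to locally Lipschitz maps on an open
  set\<close>

lemma convex_co_bar: "convex (co_bar U f)"
  by (simp add: co_bar_def convex_closure)

text \<open>Composing \<open>f\<close> with the nearest-point projection onto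
  \<open>cball c e\<close> gives a Lipschitz map on the whole space that coincides with
  \<open>f\<close> on \<open>ball c e\<close>, so the Jacobians there are those of \<open>f\<close>.
  The radius \<open>2 * e\<close> leaves room for the closed ball.\<close>

lemma local_mean_value:
  fixes f :: "real ^ 'm \<Rightarrow> real ^ 'n"
  assumes "ball c (2 * e) \<subseteq> U" "0 < e" and lip: "L-lipschitz_on (ball c (2 * e)) f"
    and "a \<in> ball c e" "b \<in> ball c e"
  shows "\<exists>A \<in> co_bar U f. A *v (b - a) = f b - f a"
proof -
  define F where "F = f \<circ> closest_point (cball c e)"
  have cp: "closest_point (cball c e) x \<in> ball c (2 * e)" for x
    using closest_point_in_set[of "cball c e" x] \<open>0 < e\<close> by auto
  have "L-lipschitz_on UNIV F"
  proof (rule lipschitz_onI)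
    fix x y
    have "dist (F x) (F y) \<le> L * dist (closest_point (cball c e) x) (closest_point (cball c e) y)"
      unfolding F_def comp_def by (rule lipschitz_onD[OF lip cp cp])
    also have "\<dots> \<le> L * dist x y"
      using closest_point_lipschitz[of "cball c e"] \<open>0 < e\<close> lipschitz_on_nonneg[OF lip]
      by (intro mult_left_mono) auto
    finally show "dist (F x) (F y) \<le> L * dist x y" .
  qed (rule lipschitz_on_nonneg[OF lip])
  moreover have "closed_segment a b \<subseteq> ball c e"
    using assms by (intro closed_segment_subset) auto
  ultimately obtain A where
    A: "A \<in> closure (convex hull {jacobian F (at x) | x. x \<in> ball c e \<and> F differentiable (at x)})"
      "A *v (b - a) = F b - F a"
    using lipschitz_mean_value[of L F "ball c e"] by blast
  have F: "F x = f x" if "x \<in> ball c e" for x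
    using that by (simp add: F_def closest_point_self)
  have "jacobian F (at x) \<in> differentials U f" if "x \<in> ball c e" "F differentiable (at x)" for x
  proof -
    have "(F has_derivative frechet_derivative F (at x)) (at x)"
      using that(2) frechet_derivative_works by blast
    then have f': "(f has_derivative frechet_derivative F (at x)) (at x)"
      by (rule has_derivative_transform_within_open[OF _ open_ball that(1)]) (rule F)
    then have "jacobian F (at x) = jacobian f (at x)"
      using frechet_derivative_at by (fastforce simp: jacobian_def)
    moreover have "f differentiable (at x)"
      using f' differentiable_def by blast
    moreover have "x \<in> U"
      using that(1) assms(1,2) by (auto simp: subset_iff)
    ultimately show ?thesis
      by (auto simp: differentials_def nondiff_set_def)
  qed
  then have "closure (convex hull {jacobian F (at x) | x. x \<in> ball c e \<and> F differentiable (at x)}) \<subseteq> co_bar U f"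
    unfolding co_bar_def by (intro closure_mono hull_mono) auto
  then show ?thesis
    using A F assms(4,5) by auto
qed

text \<open>The property holds on short subsegments around each point and passes to concatenations
  of subsegments, so Bolzano's bisection principle gives it for the whole segment.\<close>

lemma mean_value:
  fixes f :: "real ^ 'm \<Rightarrow> real ^ 'n"
  assumes "open U" and loc: "locally_lipschitz_on U f" and seg: "closed_segment a b \<subseteq> U"
  shows "\<exists>A \<in> co_bar U f. A *v (b - a) = f b - f a"
proof -
  define u where "u = b - a"
  define P where "P = (\<lambda>s t. \<exists>A \<in> co_bar U f. A *v ((t - s) *\<^sub>R u) = f (a + t *\<^sub>R u) - f (a + s *\<^sub>R u))"
  have "P 0 1"
  proof (rule Bolzano)
    fix r s t :: real assume "P r s" "P s t" "r \<le> s" "s \<le> t"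
    then obtain A B where A: "A \<in> co_bar U f" "A *v ((s - r) *\<^sub>R u) = f (a + s *\<^sub>R u) - f (a + r *\<^sub>R u)"
      and B: "B \<in> co_bar U f" "B *v ((t - s) *\<^sub>R u) = f (a + t *\<^sub>R u) - f (a + s *\<^sub>R u)"
      unfolding P_def by blast
    show "P r t"
    proof (cases "r = t")
      case True
      then show ?thesis
        using A(1) by (auto simp: P_def intro!: bexI[of _ A])
    next
      case False
      then have "r < t" using \<open>r \<le> s\<close> \<open>s \<le> t\<close> by simp
      \<comment> \<open>Weights proportional to the lengths of the two pieces, so that
        \<open>C\<close> applied to the joined segment adds up the two increments.\<close>
      define C where "C = ((s - r) / (t - r)) *\<^sub>R A + ((t - s) / (t - r)) *\<^sub>R B"
      have "C \<in> co_bar U f"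
        unfolding C_def using \<open>r < t\<close> \<open>r \<le> s\<close> \<open>s \<le> t\<close>
        by (intro convexD[OF convex_co_bar] A B) (auto simp flip: add_divide_distrib)
      moreover have "C *v ((t - r) *\<^sub>R u) = A *v ((s - r) *\<^sub>R u) + B *v ((t - s) *\<^sub>R u)"
        using \<open>r < t\<close>
        by (simp add: C_def matrix_vector_mult_add_rdistrib matrix_vector_mult_scaleR
            scaleR_matrix_vector_assoc[symmetric] scaleR_right_distrib)
      ultimately show ?thesis
        unfolding P_def using A(2) B(2) by (intro bexI[of _ C]) auto
    qed
  next
    fix r :: real assume "0 \<le> r" "r \<le> 1"
    define c where "c = a + r *\<^sub>R u"
    have "c \<in> closed_segment a b"
      using \<open>0 \<le> r\<close> \<open>r \<le> 1\<close> by (auto simp: in_segment c_def u_def algebra_simps intro!: exI[of _ r])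
    then have "c \<in> U" using seg by blast
    then obtain e1 L where "e1 > 0" and lip: "L-lipschitz_on (ball c e1 \<inter> U) f"
      using loc unfolding locally_lipschitz_on_def by blast
    obtain e2 where "e2 > 0" and e2: "ball c e2 \<subseteq> U"
      using \<open>open U\<close> \<open>c \<in> U\<close> open_contains_ball by blast
    define e where "e = min e1 e2 / 2"
    have "e > 0" and ball: "ball c (2 * e) \<subseteq> ball c e1 \<inter> U"
      using \<open>e1 > 0\<close> \<open>e2 > 0\<close> e2 by (auto simp: e_def subset_iff)
    have *: "\<exists>A \<in> co_bar U f. A *v (y - x) = f y - f x" if "x \<in> ball c e" "y \<in> ball c e" for x y
      by (rule local_mean_value[OF _ \<open>e > 0\<close> lipschitz_on_subset[OF lip ball] that]) (use ball in auto)
    show "\<exists>d>0. \<forall>s t. s \<le> r \<and> r \<le> t \<and> t - s < d \<longrightarrow> P s t"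
    proof (intro exI conjI allI impI)
      \<comment> \<open>The summand 1 covers the degenerate case \<open>u = 0\<close>.\<close>
      show "0 < e / (norm u + 1)"
        using \<open>e > 0\<close> by (simp add: add_nonneg_pos)
      fix s t assume st: "s \<le> r \<and> r \<le> t \<and> t - s < e / (norm u + 1)"
      have "a + q *\<^sub>R u \<in> ball c e" if "\<bar>r - q\<bar> < e / (norm u + 1)" for q
      proof -
        have "dist c (a + q *\<^sub>R u) = \<bar>r - q\<bar> * norm u"
          by (simp add: c_def dist_norm flip: scaleR_left_diff_distrib)
        also have "\<dots> \<le> \<bar>r - q\<bar> * (norm u + 1)"
          by (intro mult_left_mono) auto
        also have "\<dots> < e"
          using that by (simp add: pos_less_divide_eq add_nonneg_pos)
        finally show ?thesis by simp
      qed
      from *[OF this this, of s t] st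
      show "P s t"
        by (simp add: P_def flip: scaleR_left_diff_distrib)
    qed
  qed simp
  then show ?thesis
    by (simp add: P_def u_def)
qed

section \<open>Injectivity from extremality and the mean value theorem\<close>

theorem theorem3p4:
  fixes U :: "(real ^ 'm) set" and f :: "real ^ 'm \<Rightarrow> real ^ 'n"
  assumes "convex U" and "open U"
    and "locally_lipschitz_on U f"
    and "tame_on U f"
    and "\<And>v :: real ^ 'm. norm v = 1 \<Longrightarrow> extremal_in (Sigma_dir U f v) (co_bar U f)"
    and "\<And>a b. a \<noteq> b \<Longrightarrow> closed_segment a b \<subseteq> U \<Longrightarrow> \<not> f constant_on closed_segment a b"
  shows "inj_on f U"
proof (rule inj_onI, rule ccontr)
  fix a b assume "a \<in> U" "b \<in> U" and eq: "f a = f b" and "a \<noteq> b"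
  have seg: "closed_segment a b \<subseteq> U"
    using \<open>a \<in> U\<close> \<open>b \<in> U\<close> \<open>convex U\<close> by (rule closed_segment_subset)
  \<comment> \<open>Extremality is assumed for unit directions only.\<close>
  define v where "v = (b - a) /\<^sub>R norm (b - a)"
  have "norm v = 1" and ba: "b - a = norm (b - a) *\<^sub>R v"
    using \<open>a \<noteq> b\<close> by (simp_all add: v_def)
  have "f (a + t *\<^sub>R (b - a)) = f a" if "0 < t" "t < 1" for t
  proof -
    define c where "c = a + t *\<^sub>R (b - a)"
    have c: "c \<in> closed_segment a b"
      using that by (auto simp: in_segment c_def algebra_simps intro!: exI[of _ t])
    have ca: "c - a = t *\<^sub>R (b - a)" and bc: "b - c = (1 - t) *\<^sub>R (b - a)"
      by (simp_all add: c_def algebra_simps)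
    have "closed_segment a c \<subseteq> U" "closed_segment c b \<subseteq> U"
      using c seg subset_closed_segment by fastforce+
    then obtain A B where A: "A \<in> co_bar U f" "A *v (c - a) = f c - f a"
      and B: "B \<in> co_bar U f" "B *v (b - c) = f b - f c"
      using mean_value[OF \<open>open U\<close> assms(3)] by meson
    \<comment> \<open>The left side is \<open>(f c - f a) + (f b - f c)\<close>, which vanishes
      because \<open>f a = f b\<close>.\<close>
    have "(t *\<^sub>R A + (1 - t) *\<^sub>R B) *v (b - a) = 0"
      using A(2) B(2) eq unfolding ca bc
      by (simp add: matrix_vector_mult_add_rdistrib matrix_vector_mult_scaleR
            scaleR_matrix_vector_assoc[symmetric])
    then have "(t *\<^sub>R A + (1 - t) *\<^sub>R B) *v v = 0"
      by (simp add: v_def matrix_vector_mult_scaleR)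
    moreover have "t *\<^sub>R A + (1 - t) *\<^sub>R B \<in> co_bar U f"
      using that by (intro convexD[OF convex_co_bar] A B) auto
    ultimately have "t *\<^sub>R A + (1 - t) *\<^sub>R B \<in> Sigma_dir U f v"
      by (simp add: Sigma_dir_def)
    \<comment> \<open>Extremality passes the vanishing on \<open>v\<close> from the convex
      combination to \<open>A\<close>; hence \<open>f c - f a = A *v (c - a) = 0\<close>.\<close>
    then have "A \<in> Sigma_dir U f v"
      using assms(5)[OF \<open>norm v = 1\<close>] A(1) B(1) that unfolding extremal_in_def by blast
    then have "A *v (b - a) = 0"
      by (subst ba) (simp add: Sigma_dir_def matrix_vector_mult_scaleR)
    then show ?thesis
      using A(2) by (simp add: ca matrix_vector_mult_scaleR flip: c_def)
  qed
  then have "f x = f a" if "x \<in> closed_segment a b" for x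
  proof -
    obtain t where "0 \<le> t" "t \<le> 1" and x: "x = a + t *\<^sub>R (b - a)"
      using \<open>x \<in> closed_segment a b\<close> by (auto simp: in_segment algebra_simps)
    then show ?thesis
      using \<open>\<And>t. \<lbrakk>0 < t; t < 1\<rbrakk> \<Longrightarrow> f (a + t *\<^sub>R (b - a)) = f a\<close>[of t] eq by (cases "t = 0 \<or> t = 1") auto
  qed
  then have "f constant_on closed_segment a b"
    unfolding constant_on_def by blast
  with assms(6)[OF \<open>a \<noteq> b\<close> seg] show False ..
qed

end
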